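(* Let $d, g, \delta$ be positive integers and let $G$ be a finite $d$-regular graph. Assume that for every $k \leq g$ every vertex $x$ of $G$ is contained in at most $\left( \frac{d}{8\delta} \right)^k$ cycles of length $k$ in $G$. Then $G$ admits a spanning subgraph $H$ with girth at least $g$ such that $$|\partial_H S| \geq \frac{\delta}{2d}|\partial_G S|-(2\log(d)+4)|S|$$ holds for every $S \subseteq V(G)$.
   Context: Graphs are undirected and simple. A spanning subgraph $H$ of $G$ is a subgraph with $V(H)=V(G)$ and $E(H)\subseteq E(G)$. For a graph $F$ and $S\subseteq V(F)$, $\partial_F S$ denotes the edge boundary of $S$, i.e. the set of edges of $F$ with exactly one endpoint in $S$. The girth of a graph is the length of its shortest cycle ($\infty$ if it has no cycle). $\log$ is the natural logarithm.
   Formalization: Adds the hypothesis δ/2 − (2 log d + 4) ≤ d; without it the claim fails (d=1, g=1, δ=11, G=K_2, S a single vertex), and every nonempty G for which the conclusion holds satisfies it. *)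

theory Defs
  imports Complex_Main "HOL-Library.Extended_Nat"
begin

record 'a graph =
  verts :: "'a set"
  edges :: "'a set set"

definition finite_simple_graph :: "'a graph \<Rightarrow> bool" where
  "finite_simple_graph G \<longleftrightarrow>
     finite (verts G) \<and> (\<forall>e\<in>edges G. e \<subseteq> verts G \<and> card e = 2)"

definition degree :: "'a graph \<Rightarrow> 'a \<Rightarrow> nat" where
  "degree G v = card {e \<in> edges G. v \<in> e}"

definition regular :: "nat \<Rightarrow> 'a graph \<Rightarrow> bool" where
  "regular d G \<longleftrightarrow> (\<forall>v\<in>verts G. degree G v = d)"

definition subgraph :: "'a graph \<Rightarrow> 'a graph \<Rightarrow> bool" where
  "subgraph H G \<longleftrightarrow> verts H \<subseteq> verts G \<and> edges H \<subseteq> edges G"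

definition spanning_subgraph :: "'a graph \<Rightarrow> 'a graph \<Rightarrow> bool" where
  "spanning_subgraph H G \<longleftrightarrow> verts H = verts G \<and> edges H \<subseteq> edges G"

definition edge_boundary :: "'a graph \<Rightarrow> 'a set \<Rightarrow> 'a set set" where
  "edge_boundary F S = {e \<in> edges F. card (e \<inter> S) = 1}"

definition cycle_graph :: "nat \<Rightarrow> 'a graph \<Rightarrow> bool" where
  "cycle_graph k C \<longleftrightarrow> (\<exists>xs. k \<ge> 3 \<and> length xs = k \<and> distinct xs \<and>
     verts C = set xs \<and>
     edges C = {{xs ! i, xs ! (Suc i mod k)} | i. i < k})"

(* Cycles are subgraphs: the 2k cyclic vertex sequences that trace out the same
   cycle of length k are counted once. *)
definition cycles :: "'a graph \<Rightarrow> nat \<Rightarrow> 'a graph set" where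
  "cycles G k = {C. subgraph C G \<and> cycle_graph k C}"

(* The infimum of the empty set in enat is \<infinity>. *)
definition girth :: "'a graph \<Rightarrow> enat" where
  "girth G = (INF k \<in> {k. cycles G k \<noteq> {}}. enat k)"

end

(* If 8 \<delta> > d, the hypothesis forbids all cycles of length at most g and H = G works.
   Otherwise keep each edge of G independently with probability p = \<delta> / d and apply the
   asymmetric Lovasz local lemma to two kinds of bad events: a cycle C of length k < g survives
   (probability p^k, weight (2 p)^k), or a connected set S violates the boundary inequality
   (probability at most exp (- (2 ln d + 4) |S|) by an exponential moment bound, weight
   (8 d^2)^(-|S|)). A connected set with t vertices is the vertex set of a walk with 2 (t - 1)
   steps, so at most d^(2 (t - 1)) of them contain a given vertex. Hence the events whose edge
   sets meet that of an event supported on n vertices have total weight at most n / 4. The boundary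
   inequality is additive over parts of S with no edge of G between them, so connected S suffice. *)
theory Submission
  imports "HOL-Probability.Product_PMF" Defs
begin

section \<open>The asymmetric Lovasz local lemma\<close>

text \<open>The heart is \<open>prob (A i \<inter> G J) \<le> x i * prob (G J)\<close>, where
  \<open>G J\<close> avoids all events indexed by \<open>J\<close>; multiplying out over
  \<open>I\<close> gives the product. Conditional probabilities are written as products, so no
  \<open>prob (G J)\<close> has to be known positive. \<open>N i\<close> may contain
  \<open>i\<close> itself.\<close>

lemma (in prob_space) lovasz_local_lemma:
  fixes x :: "'i \<Rightarrow> real"
  assumes "finite I"
    and events: "\<And>i. i \<in> I \<Longrightarrow> A i \<in> events"
    and indep: "\<And>i J. i \<in> I \<Longrightarrow> J \<subseteq> I - N i \<Longrightarrow>
      prob (A i \<inter> (space M - (\<Union>j\<in>J. A j))) = prob (A i) * prob (space M - (\<Union>j\<in>J. A j))"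
    and N: "\<And>i. i \<in> I \<Longrightarrow> N i \<subseteq> I"
    and x: "\<And>i. i \<in> I \<Longrightarrow> 0 \<le> x i" "\<And>i. i \<in> I \<Longrightarrow> x i \<le> 1"
    and bound: "\<And>i. i \<in> I \<Longrightarrow> prob (A i) \<le> x i * (\<Prod>j\<in>N i. 1 - x j)"
  shows "(\<Prod>i\<in>I. 1 - x i) \<le> prob (space M - (\<Union>i\<in>I. A i))"
proof -
  define G where "G J = space M - (\<Union>j\<in>J. A j)" for J
  have G_event: "G J \<in> events" if "J \<subseteq> I" for J
    using that \<open>finite I\<close> events unfolding G_def
    by (intro sets.compl_sets sets.finite_UN) (auto intro: finite_subset)
  have G_insert: "prob (G (insert i J)) = prob (G J) - prob (A i \<inter> G J)"
    if "i \<in> I" "J \<subseteq> I" for i J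
  proof -
    have "prob (G J - A i \<inter> G J) = prob (G J) - prob (A i \<inter> G J)"
      using G_event[OF that(2)] events[OF that(1)] by (intro finite_measure_Diff) auto
    moreover have "G (insert i J) = G J - A i \<inter> G J" unfolding G_def by auto
    ultimately show ?thesis by simp
  qed
  \<comment> \<open>The events of \<open>K\<close> are peeled off one at a time, each costing a
    factor \<open>1 - x k\<close>. The bound is assumed only for proper subsets of
    \<open>K \<union> L\<close>, so an induction hypothesis can supply it as well as the finished
    result.\<close>
  have chain: "(\<Prod>j\<in>K. 1 - x j) * prob (G L) \<le> prob (G (K \<union> L))"
    if "K \<union> L \<subseteq> I" "K \<inter> L = {}"
      and IH: "\<And>i J. i \<in> I \<Longrightarrow> J \<subset> K \<union> L \<Longrightarrow> prob (A i \<inter> G J) \<le> x i * prob (G J)"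
    for K L
  proof -
    have "finite K" using that(1) \<open>finite I\<close> by (meson finite_subset le_sup_iff)
    then show ?thesis using that
    proof (induction K)
      case empty then show ?case by simp
    next
      case (insert k K)
      have k: "k \<in> I" "k \<notin> K \<union> L" "K \<union> L \<subseteq> I" using insert by auto
      have IH: "(\<Prod>j\<in>K. 1 - x j) * prob (G L) \<le> prob (G (K \<union> L))"
        using insert.prems by (intro insert.IH) auto
      have "prob (A k \<inter> G (K \<union> L)) \<le> x k * prob (G (K \<union> L))"
        using k by (intro insert.prems(3)) auto
      then have "(1 - x k) * prob (G (K \<union> L)) \<le> prob (G (insert k (K \<union> L)))"
        using G_insert[OF k(1,3)] by (simp add: algebra_simps)
      moreover have "(1 - x k) * ((\<Prod>j\<in>K. 1 - x j) * prob (G L)) \<le> (1 - x k) * prob (G (K \<union> L))"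
        using IH x(2)[OF k(1)] by (intro mult_left_mono) auto
      ultimately show ?case using insert.hyps by (simp add: mult.assoc)
    qed
  qed
  have main: "prob (A i \<inter> G J) \<le> x i * prob (G J)" if "i \<in> I" "J \<subseteq> I" for i J
    using that
  proof (induction "card J" arbitrary: i J rule: less_induct)
    case less
    have "finite J" using less.prems \<open>finite I\<close> finite_subset by blast
    define K where "K = J \<inter> N i"
    define L where "L = J - N i"
    have KL: "K \<union> L = J" "K \<inter> L = {}" unfolding K_def L_def by auto
    \<comment> \<open>Independence is available only for the events in \<open>L\<close>. So
      \<open>G J\<close> is enlarged to \<open>G L\<close>, and \<open>chain\<close> leads back from
      \<open>G L\<close> to \<open>G J\<close> at the price of the factors over \<open>K\<close>, a
      part of \<open>N i\<close>.\<close>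
    have "G L \<in> events" using less.prems by (intro G_event) (auto simp: L_def)
    then have "prob (A i \<inter> G J) \<le> prob (A i \<inter> G L)"
      using events[OF less.prems(1)]
      by (intro finite_measure_mono sets.Int) (auto simp: G_def L_def)
    also have "\<dots> = prob (A i) * prob (G L)"
      unfolding G_def using less.prems L_def by (intro indep) auto
    also have "\<dots> \<le> (x i * (\<Prod>j\<in>N i. 1 - x j)) * prob (G L)"
      by (intro mult_right_mono bound less.prems) auto
    also have "\<dots> \<le> (x i * (\<Prod>j\<in>K. 1 - x j)) * prob (G L)"
    proof -
      have "(\<Prod>j\<in>N i. 1 - x j) \<le> (\<Prod>j\<in>K. 1 - x j)"
      proof -
        have sub: "N i \<subseteq> I" "K \<subseteq> N i" using N less.prems by (auto simp: K_def)
        then have "finite (N i)" using \<open>finite I\<close> finite_subset by blast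
        then have "(\<Prod>j\<in>N i. 1 - x j) = (\<Prod>j\<in>N i - K. 1 - x j) * (\<Prod>j\<in>K. 1 - x j)"
          using sub by (intro prod.subset_diff)
        also have "\<dots> \<le> 1 * (\<Prod>j\<in>K. 1 - x j)"
          using x sub by (intro mult_right_mono prod_le_1 prod_nonneg) (auto simp: subset_iff)
        finally show ?thesis by simp
      qed
      then show ?thesis using x(1)[OF less.prems(1)]
        by (intro mult_right_mono mult_left_mono) auto
    qed
    also have "\<dots> = x i * ((\<Prod>j\<in>K. 1 - x j) * prob (G L))" by simp
    also have "\<dots> \<le> x i * prob (G (K \<union> L))"
    proof (intro mult_left_mono chain)
      fix i' J' assume "i' \<in> I" "J' \<subset> K \<union> L"
      then show "prob (A i' \<inter> G J') \<le> x i' * prob (G J')"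
        using less KL \<open>finite J\<close> by (metis order.trans psubset_card_mono psubset_imp_subset)
    qed (use KL less.prems x(1) in auto)
    finally show ?case using KL by simp
  qed
  have "(\<Prod>i\<in>I. 1 - x i) * prob (G {}) \<le> prob (G (I \<union> {}))"
    by (rule chain) (use main in auto)
  then show ?thesis by (simp add: G_def prob_space)
qed

section \<open>Random edge sets: independence and tail bounds\<close>

text \<open>Intersecting with the supports makes both factors countable, and there the product rule
  applies.\<close>

lemma prob_pair_pmf:
  "measure_pmf.prob (pair_pmf M N) (A \<times> B) = measure_pmf.prob M A * measure_pmf.prob N B"
proof -
  have "measure_pmf.prob (pair_pmf M N) (A \<times> B)
      = measure_pmf.prob (pair_pmf M N) ((A \<inter> set_pmf M) \<times> (B \<inter> set_pmf N))"
    by (subst measure_Int_set_pmf[symmetric], rule arg_cong[where f = "measure_pmf.prob _"]) auto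
  also have "\<dots> = measure_pmf.prob M (A \<inter> set_pmf M) * measure_pmf.prob N (B \<inter> set_pmf N)"
    by (intro measure_pmf_prob_product) auto
  finally show ?thesis by (simp add: measure_Int_set_pmf)
qed

text \<open>Splitting the coordinates into \<open>X\<close> and \<open>E - X\<close> turns a random
  function into a pair of independent ones; \<open>A\<close> sees only the first and
  \<open>B\<close> only the second. In the local lemma, \<open>A\<close> is a bad event and
  \<open>B\<close> the avoidance of bad events on other edges.\<close>

lemma prob_Pi_pmf_Int_disjoint_coordinates:
  assumes "finite E" "X \<subseteq> E" "Y \<subseteq> E" "X \<inter> Y = {}"
    and A: "\<And>f h. (\<And>e. e \<in> X \<Longrightarrow> f e = h e) \<Longrightarrow> f \<in> A \<longleftrightarrow> h \<in> A"
    and B: "\<And>f h. (\<And>e. e \<in> Y \<Longrightarrow> f e = h e) \<Longrightarrow> f \<in> B \<longleftrightarrow> h \<in> B"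
  shows "measure_pmf.prob (Pi_pmf E dflt p) (A \<inter> B)
    = measure_pmf.prob (Pi_pmf E dflt p) A * measure_pmf.prob (Pi_pmf E dflt p) B"
proof -
  define P where "P = Pi_pmf X dflt p"
  define Q where "Q = Pi_pmf (E - X) dflt p"
  define merge where "merge = (\<lambda>(f,g) x. if x \<in> X then f x else g x :: 'b)"
  have "Pi_pmf (X \<union> (E - X)) dflt p = map_pmf merge (pair_pmf P Q)"
    unfolding merge_def P_def Q_def using assms by (intro Pi_pmf_union) (auto intro: finite_subset)
  then have E: "Pi_pmf E dflt p = map_pmf merge (pair_pmf P Q)"
    using \<open>X \<subseteq> E\<close> by (simp add: Un_absorb1)
  have mA: "merge (f, h) \<in> A \<longleftrightarrow> f \<in> A" for f h
    by (rule A) (auto simp: merge_def)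
  have mB: "merge (f, h) \<in> B \<longleftrightarrow> h \<in> B" for f h
    by (rule B) (use assms in \<open>auto simp: merge_def\<close>)
  have "merge -` (A \<inter> B) = A \<times> B" "merge -` A = A \<times> UNIV" "merge -` B = UNIV \<times> B"
    using mA mB by auto
  then show ?thesis unfolding E by (simp add: measure_map_pmf prob_pair_pmf)
qed

lemma prob_Pi_pmf_bernoulli_all:
  assumes "finite E" "B \<subseteq> E" "0 \<le> p" "p \<le> 1"
  shows "measure_pmf.prob (Pi_pmf E False (\<lambda>_. bernoulli_pmf p)) {f. \<forall>e\<in>B. f e} = p ^ card B"
proof -
  have "measure_pmf.prob (Pi_pmf E False (\<lambda>_. bernoulli_pmf p)) (Pi E (\<lambda>e. if e \<in> B then {True} else UNIV))
     = (\<Prod>e\<in>E. if e \<in> B then p else 1)"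
    unfolding measure_Pi_pmf_Pi[OF assms(1)]
    by (intro prod.cong) (use assms in \<open>auto simp: measure_pmf_single\<close>)
  also have "\<dots> = p ^ card B"
    using assms by (simp add: prod.If_cases Int_absorb1)
  also have "Pi E (\<lambda>e. if e \<in> B then {True} else UNIV) = {f. \<forall>e\<in>B. f e}"
    using assms by (auto simp: Pi_def split: if_splits)
  finally show ?thesis .
qed

(* Markov's inequality for exp (- X), where X = card {e \<in> B. f e}. *)
lemma prob_Pi_pmf_bernoulli_lower_tail:
  assumes "finite E" "B \<subseteq> E" "0 \<le> p" "p \<le> 1"
  shows "measure_pmf.prob (Pi_pmf E False (\<lambda>_. bernoulli_pmf p))
      {f. real (card {e \<in> B. f e}) < p / 2 * real (card B) - t} \<le> exp (- t)"
proof -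
  define M where "M = Pi_pmf E False (\<lambda>_. bernoulli_pmf p)"
  define a where "a = p / 2 * real (card B) - t"
  \<comment> \<open>This is the factor of exp (- X) that belongs to the coordinate \<open>e\<close>;
    coordinates outside \<open>B\<close> contribute 1, so the product may run over all of
    \<open>E\<close>.\<close>
  define \<phi> where "\<phi> e v = (if e \<in> B \<and> v then exp (- 1) else 1 :: real)" for e v
  have finB: "finite B" using assms finite_subset by blast
  have prod_\<phi>: "(\<Prod>e\<in>E. \<phi> e (f e)) = exp (- real (card {e \<in> B. f e}))" for f
  proof -
    have "(\<Prod>e\<in>E. \<phi> e (f e)) = (\<Prod>e\<in>{e \<in> B. f e}. exp (- 1))"
      using assms finB by (intro prod.mono_neutral_cong_right) (auto simp: \<phi>_def)
    also have "\<dots> = exp (- real (card {e \<in> B. f e}))"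
      by (simp flip: exp_of_nat_mult)
    finally show ?thesis .
  qed
  have fin: "finite (set_pmf M)"
    unfolding M_def using assms(1) by (subst set_Pi_pmf) auto
  have "measure_pmf.prob M {f. real (card {e \<in> B. f e}) < a}
      = measure_pmf.expectation M (indicator {f. real (card {e \<in> B. f e}) < a})"
    by simp
  also have "\<dots> \<le> measure_pmf.expectation M (\<lambda>f. exp a * (\<Prod>e\<in>E. \<phi> e (f e)))"
  proof (rule integral_mono)
    fix f
    show "indicator {f. real (card {e \<in> B. f e}) < a} f \<le> exp a * (\<Prod>e\<in>E. \<phi> e (f e))"
      unfolding prod_\<phi> by (auto simp: indicator_def simp flip: exp_add)
  qed (auto intro: integrable_measure_pmf_finite fin)
  also have "\<dots> = exp a * measure_pmf.expectation M (\<lambda>f. \<Prod>e\<in>E. \<phi> e (f e))" by simp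
  also have "measure_pmf.expectation M (\<lambda>f. \<Prod>e\<in>E. \<phi> e (f e))
      = (\<Prod>e\<in>E. measure_pmf.expectation (bernoulli_pmf p) (\<phi> e))"
    unfolding M_def using assms(1)
    by (intro expectation_prod_Pi_pmf integrable_measure_pmf_finite) (auto simp: \<phi>_def)
  also have "\<dots> = (\<Prod>e\<in>B. p * exp (- 1) + (1 - p))"
    using assms by (intro prod.mono_neutral_cong_right) (auto simp: \<phi>_def)
  also have "\<dots> \<le> (\<Prod>e\<in>B. exp (- (p / 2)))"
  proof (rule prod_mono)
    \<comment> \<open>Each factor is 1 - p (1 - 1 / e), at most 1 - p / 2 because e \<ge> 2, hence
      at most exp (- p / 2).\<close>
    have "2 \<le> exp (1::real)" using exp_ge_add_one_self[of 1] by simp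
    then have "exp (- 1 :: real) \<le> 1 / 2" by (simp add: exp_minus field_simps)
    then have "p * exp (- 1) \<le> p * (1 / 2)" using assms by (intro mult_left_mono) auto
    then show "0 \<le> p * exp (- 1) + (1 - p) \<and> p * exp (- 1) + (1 - p) \<le> exp (- (p / 2))" for e
      using assms exp_ge_add_one_self[of "- (p / 2)"] by auto
  qed
  also have "\<dots> = exp (- (p / 2 * real (card B)))"
    by (simp flip: exp_of_nat_mult add: mult.commute)
  finally show ?thesis
    unfolding M_def a_def by (simp flip: exp_add)
qed

section \<open>Sums over unions and geometric sums\<close>

lemma sum_UN_le:
  fixes f :: "'b \<Rightarrow> real"
  assumes "finite K" "\<And>k. k \<in> K \<Longrightarrow> finite (A k)" "\<And>x. 0 \<le> f x"
  shows "sum f (\<Union>k\<in>K. A k) \<le> (\<Sum>k\<in>K. sum f (A k))"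
  using assms(1,2)
proof (induction K)
  case (insert k K)
  have "sum f (\<Union>k\<in>insert k K. A k) \<le> sum f (A k) + sum f (\<Union>k\<in>K. A k)"
    using insert assms(3) by (simp add: sum_Un sum_nonneg)
  also have "\<dots> \<le> sum f (A k) + (\<Sum>k\<in>K. sum f (A k))"
    using insert by simp
  finally show ?case using insert by simp
qed simp

lemma sum_geometric_le:
  fixes r :: real
  assumes "0 \<le> r" "r < 1"
  shows "(\<Sum>k=m..n. r ^ k) \<le> r ^ m / (1 - r)"
proof (cases "m \<le> n")
  case True
  have "(1 - r) * (\<Sum>k=m..n. r ^ k) \<le> r ^ m"
    using sum_gp_multiplied[OF True, of r] assms by simp
  then show ?thesis using assms by (simp add: field_simps)
qed (use assms in simp)

section \<open>Edges, neighbours and edge boundaries\<close>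

lemma finite_edges:
  assumes "finite_simple_graph G"
  shows "finite (edges G)"
proof -
  have "edges G \<subseteq> Pow (verts G)" using assms by (auto simp: finite_simple_graph_def)
  then show ?thesis using assms by (meson finite_Pow_iff finite_simple_graph_def finite_subset)
qed

lemma edge_cases:
  assumes "finite_simple_graph G" "e \<in> edges G"
  obtains u v where "e = {u, v}" "u \<noteq> v" "u \<in> verts G" "v \<in> verts G"
proof -
  have "card e = 2" "e \<subseteq> verts G" using assms by (auto simp: finite_simple_graph_def)
  then show thesis using that by (auto simp: card_2_iff)
qed

lemma insert_mem_edge_boundary_iff:
  assumes "u \<noteq> v"
  shows "{u, v} \<in> edge_boundary F S \<longleftrightarrow> {u, v} \<in> edges F \<and> (u \<in> S) \<noteq> (v \<in> S)"
proof -
  have "{u, v} \<inter> S = (if u \<in> S then {u} else {}) \<union> (if v \<in> S then {v} else {})" by auto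
  then show ?thesis using assms by (auto simp: edge_boundary_def)
qed

lemma card_neighbours_le_degree:
  assumes "finite_simple_graph G"
  shows "finite {u. {v, u} \<in> edges G}" "card {u. {v, u} \<in> edges G} \<le> degree G v"
proof -
  have fin: "finite {e \<in> edges G. v \<in> e}" using finite_edges[OF assms] by simp
  have inj: "inj_on (\<lambda>u. {v, u}) {u. {v, u} \<in> edges G}"
    by (auto simp: inj_on_def doubleton_eq_iff)
  have sub: "(\<lambda>u. {v, u}) ` {u. {v, u} \<in> edges G} \<subseteq> {e \<in> edges G. v \<in> e}" by auto
  show "finite {u. {v, u} \<in> edges G}" using inj_on_finite[OF inj sub fin] .
  show "card {u. {v, u} \<in> edges G} \<le> degree G v"
    unfolding degree_def using card_inj_on_le[OF inj sub fin] .
qed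

text \<open>Each boundary edge is charged to its endpoint in \<open>S\<close>. This serves the range
  of large \<delta>, where \<open>G\<close> itself is the subgraph.\<close>

lemma card_edge_boundary_le:
  assumes "finite_simple_graph G" "finite S" "\<And>v. v \<in> S \<Longrightarrow> degree G v \<le> d"
  shows "card (edge_boundary G S) \<le> d * card S"
proof -
  have "card (edge_boundary G S) \<le> card (\<Union>v\<in>S. {e \<in> edges G. v \<in> e})"
  proof (rule card_mono)
    show "edge_boundary G S \<subseteq> (\<Union>v\<in>S. {e \<in> edges G. v \<in> e})"
      by (fastforce simp: edge_boundary_def card_1_singleton_iff)
  qed (use assms(2) finite_edges[OF assms(1)] in auto)
  also have "\<dots> \<le> (\<Sum>v\<in>S. card {e \<in> edges G. v \<in> e})"
    by (rule card_UN_le) fact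
  also have "\<dots> \<le> (\<Sum>v\<in>S. d)"
    using assms(3) by (intro sum_mono) (simp add: degree_def)
  finally show ?thesis by (simp add: mult.commute)
qed

section \<open>Connected sets and reduction of the boundary inequality to them\<close>

text \<open>This is connectedness of the subgraph induced on \<open>S\<close>, phrased by cuts:
  failure hands over a splitting of \<open>S\<close>, and validity hands over an edge leaving any
  partial exploration. The empty set qualifies vacuously.\<close>

definition cut_connected :: "'a graph \<Rightarrow> 'a set \<Rightarrow> bool" where
  "cut_connected G S \<longleftrightarrow>
     (\<forall>A. A \<subset> S \<longrightarrow> A \<noteq> {} \<longrightarrow> (\<exists>a\<in>A. \<exists>b\<in>S - A. {a, b} \<in> edges G))"

text \<open>If \<open>S\<close> is not connected, it splits into \<open>A\<close> and
  \<open>B\<close> with no edge of \<open>G\<close> between them. Both boundary sizes and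
  \<open>card S\<close> are then additive, so the inequalities for the two smaller sets add
  up.\<close>

lemma edge_boundary_bound_if_cut_connected:
  fixes \<alpha> c :: real
  assumes G: "finite_simple_graph G" and H: "edges H \<subseteq> edges G"
    and conn: "\<And>S. S \<subseteq> verts G \<Longrightarrow> S \<noteq> {} \<Longrightarrow> cut_connected G S \<Longrightarrow>
      \<alpha> * real (card (edge_boundary G S)) - c * real (card S) \<le> real (card (edge_boundary H S))"
    and "S \<subseteq> verts G"
  shows "\<alpha> * real (card (edge_boundary G S)) - c * real (card S) \<le> real (card (edge_boundary H S))"
  using \<open>S \<subseteq> verts G\<close>
proof (induction "card S" arbitrary: S rule: less_induct)
  case less
  have "finite S" using less.prems G by (meson finite_simple_graph_def finite_subset)
  show ?case
  proof (cases "cut_connected G S")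
    case True
    then show ?thesis
    proof (cases "S = {}")
      case False then show ?thesis using True less.prems conn by blast
    qed (simp add: edge_boundary_def)
  next
    case False
    then obtain A where A: "A \<subset> S" "A \<noteq> {}" "\<And>a b. a \<in> A \<Longrightarrow> b \<in> S - A \<Longrightarrow> {a, b} \<notin> edges G"
      unfolding cut_connected_def by blast
    define B where "B = S - A"
    \<comment> \<open>Stated for every \<open>F\<close> with edges in \<open>G\<close>, since
      additivity is needed for \<open>G\<close> and for \<open>H\<close>.\<close>
    have split: "card (edge_boundary F S) = card (edge_boundary F A) + card (edge_boundary F B)"
      if "edges F \<subseteq> edges G" for F :: "'a graph"
    proof -
      \<comment> \<open>An edge with an endpoint in \<open>A\<close> has its other endpoint in
        \<open>A\<close> or outside \<open>S\<close>, and likewise for \<open>B\<close>. So no edge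
        lies in both boundaries, and none is lost in passing to \<open>S\<close>.\<close>
      have mem: "(e \<in> edge_boundary F S \<longleftrightarrow> e \<in> edge_boundary F A \<or> e \<in> edge_boundary F B) \<and>
            \<not> (e \<in> edge_boundary F A \<and> e \<in> edge_boundary F B)" for e
      proof (cases "e \<in> edges F")
        case True
        then have eG: "e \<in> edges G" using that by blast
        obtain u v where e: "e = {u, v}" "u \<noteq> v" using edge_cases[OF G eG] .
        have "\<not> (u \<in> A \<and> v \<in> B)" "\<not> (v \<in> A \<and> u \<in> B)"
          using A(3)[of u v] A(3)[of v u] eG unfolding e(1) B_def by (auto simp: insert_commute)
        then show ?thesis
          using A(1) True unfolding e(1) insert_mem_edge_boundary_iff[OF e(2)] B_def
          by (cases "u \<in> A"; cases "v \<in> A"; cases "u \<in> S"; cases "v \<in> S") auto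
      qed (auto simp: edge_boundary_def)
      have "finite (edges F)" using finite_edges[OF G] that finite_subset by blast
      then have "finite (edge_boundary F A)" "finite (edge_boundary F B)"
        by (auto simp: edge_boundary_def)
      moreover have "edge_boundary F S = edge_boundary F A \<union> edge_boundary F B"
        "edge_boundary F A \<inter> edge_boundary F B = {}"
        using mem by blast+
      ultimately show ?thesis by (simp add: card_Un_disjoint)
    qed
    have "B \<subset> S" using A by (auto simp: B_def)
    have "S = A \<union> B" "A \<inter> B = {}" using A(1) by (auto simp: B_def)
    then have card: "card S = card A + card B"
      using \<open>finite S\<close> by (simp add: card_Un_disjoint)
    have "card A < card S" "card B < card S"
      using psubset_card_mono[OF \<open>finite S\<close>] A(1) \<open>B \<subset> S\<close> by simp_all
    then have "\<alpha> * real (card (edge_boundary G A)) - c * real (card A) \<le> real (card (edge_boundary H A))"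
      "\<alpha> * real (card (edge_boundary G B)) - c * real (card B) \<le> real (card (edge_boundary H B))"
      using less.hyps[of A] less.hyps[of B] less.prems A(1) \<open>B \<subset> S\<close> by simp_all
    then show ?thesis using split[OF H] split[of G] card by (simp add: algebra_simps)
  qed
qed

section \<open>Counting connected sets by walks\<close>

definition walks :: "'a graph \<Rightarrow> nat \<Rightarrow> 'a \<Rightarrow> 'a list set" where
  "walks G n v = {w. length w = Suc n \<and> hd w = v \<and> successively (\<lambda>a b. {a, b} \<in> edges G) w}"

text \<open>Each step has at most \<open>d\<close> choices. Finiteness is carried through the
  induction because monotonicity of \<open>card\<close> needs it.\<close>

lemma card_walks_le:
  assumes "finite_simple_graph G" "\<And>v. v \<in> verts G \<Longrightarrow> degree G v \<le> d" "v \<in> verts G"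
  shows "finite (walks G n v) \<and> card (walks G n v) \<le> d ^ n"
  using assms(3)
proof (induction n arbitrary: v)
  case 0
  have "walks G 0 v = {[v]}" by (auto simp: walks_def length_Suc_conv)
  then show ?case by simp
next
  case (Suc n)
  let ?N = "{u. {v, u} \<in> edges G}"
  have N: "u \<in> verts G" if "u \<in> ?N" for u
    using that assms(1) by (auto simp: finite_simple_graph_def)
  have sub: "walks G (Suc n) v \<subseteq> (\<Union>u\<in>?N. (#) v ` walks G n u)"
  proof
    fix w assume "w \<in> walks G (Suc n) v"
    then obtain u w' where "w = v # u # w'" "length w' = n" "{v, u} \<in> edges G"
      "successively (\<lambda>a b. {a, b} \<in> edges G) (u # w')"
      by (auto simp: walks_def length_Suc_conv)
    then show "w \<in> (\<Union>u\<in>?N. (#) v ` walks G n u)" by (auto simp: walks_def)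
  qed
  have fin: "finite (\<Union>u\<in>?N. (#) v ` walks G n u)"
    using Suc.IH N card_neighbours_le_degree[OF assms(1)] by auto
  have "card (walks G (Suc n) v) \<le> card (\<Union>u\<in>?N. (#) v ` walks G n u)"
    by (rule card_mono[OF fin sub])
  also have "\<dots> \<le> (\<Sum>u\<in>?N. card ((#) v ` walks G n u))"
    by (intro card_UN_le card_neighbours_le_degree assms)
  also have "\<dots> \<le> (\<Sum>u\<in>?N. d ^ n)"
    using Suc.IH N by (intro sum_mono) (simp add: card_image)
  also have "\<dots> = card ?N * d ^ n" by simp
  also have "\<dots> \<le> d * d ^ n"
    using card_neighbours_le_degree(2)[OF assms(1), of v] assms(2)[OF Suc.prems]
    by (intro mult_right_mono) auto
  finally show ?case using fin sub finite_subset by auto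
qed

(* The walk picks up one new vertex at a time by a detour a, b, a along an edge leaving
   the set of vertices visited so far. *)
lemma cut_connected_walk:
  assumes "finite S" "cut_connected G S" "v \<in> S" "n < card S"
  shows "\<exists>w\<in>walks G (2 * n) v. set w \<subseteq> S \<and> card (set w) = Suc n"
  using \<open>n < card S\<close>
proof (induction n)
  case 0
  have "[v] \<in> walks G (2 * 0) v" by (simp add: walks_def)
  then show ?case using \<open>v \<in> S\<close> by (intro bexI[of _ "[v]"]) auto
next
  case (Suc n)
  then obtain w where w: "w \<in> walks G (2 * n) v" "set w \<subseteq> S" "card (set w) = Suc n" by auto
  then have "set w \<subset> S" "set w \<noteq> {}" using Suc.prems by auto
  then obtain a b where ab: "a \<in> set w" "b \<in> S - set w" "{a, b} \<in> edges G"
    using assms(2) unfolding cut_connected_def by meson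
  obtain us vs where us: "w = us @ a # vs" using ab(1) by (meson split_list)
  define w' where "w' = us @ a # b # a # vs"
  have "w' \<in> walks G (2 * Suc n) v"
    using w(1) ab(3) unfolding w'_def us walks_def
    by (cases us) (auto simp: successively_append_iff successively_Cons insert_commute hd_append)
  moreover have "set w' = insert b (set w)" by (auto simp: w'_def us)
  ultimately show ?case using w ab by (intro bexI[of _ w']) auto
qed

text \<open>A walk from \<open>v\<close> with \<open>2 * n\<close> steps inside \<open>S\<close>
  that visits \<open>Suc n\<close> vertices has visited all of \<open>S\<close>, so
  \<open>set\<close> maps the walks onto a superset of this family.\<close>

lemma card_cut_connected_le:
  assumes "finite_simple_graph G" "\<And>v. v \<in> verts G \<Longrightarrow> degree G v \<le> d" "v \<in> verts G"
  shows "card {S. S \<subseteq> verts G \<and> cut_connected G S \<and> v \<in> S \<and> card S = Suc n} \<le> d ^ (2 * n)"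
proof -
  have "{S. S \<subseteq> verts G \<and> cut_connected G S \<and> v \<in> S \<and> card S = Suc n} \<subseteq> set ` walks G (2 * n) v"
  proof clarify
    fix S assume S: "S \<subseteq> verts G" "cut_connected G S" "v \<in> S" "card S = Suc n"
    have "finite S" using S(1) assms(1) by (meson finite_simple_graph_def finite_subset)
    with S obtain w where "w \<in> walks G (2 * n) v" "set w \<subseteq> S" "card (set w) = card S"
      using cut_connected_walk[of S G v n] by auto
    then show "S \<in> set ` walks G (2 * n) v" using \<open>finite S\<close> card_subset_eq by blast
  qed
  then have "card {S. S \<subseteq> verts G \<and> cut_connected G S \<and> v \<in> S \<and> card S = Suc n} \<le> card (walks G (2 * n) v)"
    using card_walks_le[OF assms] by (meson card_image_le card_mono finite_imageI order_trans)
  also have "\<dots> \<le> d ^ (2 * n)" using card_walks_le[OF assms] by blast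
  finally show ?thesis .
qed

section \<open>Cycles\<close>

lemma cycle_graphD:
  assumes "cycle_graph k C"
  shows "3 \<le> k" "finite (verts C)" "card (verts C) = k" "card (edges C) = k"
    "\<And>e. e \<in> edges C \<Longrightarrow> e \<subseteq> verts C"
proof -
  obtain xs where k: "3 \<le> k" and xs: "length xs = k" "distinct xs" "verts C = set xs"
    and edges: "edges C = {{xs ! i, xs ! (Suc i mod k)} | i. i < k}"
    using assms unfolding cycle_graph_def by blast
  show "3 \<le> k" by fact
  show "finite (verts C)" "card (verts C) = k" using xs distinct_card by auto
  \<comment> \<open>Two different indices could give the same edge only if each were the cyclic
    successor of the other, which \<open>3 \<le> k\<close> excludes.\<close>
  have "inj_on (\<lambda>i. {xs ! i, xs ! (Suc i mod k)}) {..<k}"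
  proof (rule inj_onI)
    fix i j
    assume "i \<in> {..<k}" "j \<in> {..<k}"
      and "{xs ! i, xs ! (Suc i mod k)} = {xs ! j, xs ! (Suc j mod k)}"
    then have "i = j \<or> (i = Suc j mod k \<and> Suc i mod k = j)"
      using xs k by (auto simp: doubleton_eq_iff nth_eq_iff_index_eq)
    then show "i = j" using k \<open>i \<in> _\<close> \<open>j \<in> _\<close> by (auto simp: mod_Suc split: if_splits)
  qed
  moreover have img: "edges C = (\<lambda>i. {xs ! i, xs ! (Suc i mod k)}) ` {..<k}"
    using edges by auto
  ultimately show "card (edges C) = k" by (simp add: card_image)
  show "e \<subseteq> verts C" if "e \<in> edges C" for e
  proof -
    from that obtain i where i: "i \<in> {..<k}" and e: "e = {xs ! i, xs ! (Suc i mod k)}"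
      unfolding img by (rule imageE)
    have "Suc i mod k < k" using k by simp
    then show ?thesis using xs i e by auto
  qed
qed

lemma finite_cycles:
  assumes "finite_simple_graph G"
  shows "finite (cycles G k)"
proof -
  have "cycles G k \<subseteq> (\<lambda>(V, E). \<lparr>verts = V, edges = E\<rparr>) ` (Pow (verts G) \<times> Pow (edges G))"
  proof
    fix C :: "'a graph" assume "C \<in> cycles G k"
    then have "verts C \<subseteq> verts G" "edges C \<subseteq> edges G" by (auto simp: cycles_def subgraph_def)
    then show "C \<in> (\<lambda>(V, E). \<lparr>verts = V, edges = E\<rparr>) ` (Pow (verts G) \<times> Pow (edges G))"
      by (intro image_eqI[of _ _ "(verts C, edges C)"]) auto
  qed
  then show ?thesis
    using assms finite_edges[OF assms] finite_subset by (fastforce simp: finite_simple_graph_def)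
qed

section \<open>Weights of bad events and numerical estimates\<close>

text \<open>There are at most d^(2 n) such sets with n + 1 elements, each of weight (8 d^2)^(-(n +
  1)). The geometric series with first term 1 / (8 d^2) and ratio 1 / 8 is bounded by the right-hand
  side.\<close>

lemma sum_cut_connected_weights_le:
  assumes "finite_simple_graph G" "\<And>v. v \<in> verts G \<Longrightarrow> degree G v \<le> d" "v \<in> verts G" "0 < d"
  shows "(\<Sum>S | S \<subseteq> verts G \<and> cut_connected G S \<and> v \<in> S. (1 / (8 * real d ^ 2)) ^ card S)
    \<le> 1 / (7 * real d ^ 2)"
proof -
  define q where "q = 1 / (8 * real d ^ 2)"
  define K where "K n = {S. S \<subseteq> verts G \<and> cut_connected G S \<and> v \<in> S \<and> card S = Suc n}" for n
  have finV: "finite (verts G)" using assms by (simp add: finite_simple_graph_def)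
  then have fin: "finite (K n)" for n by (auto simp: K_def intro: finite_subset[of _ "Pow (verts G)"])
  have "{S. S \<subseteq> verts G \<and> cut_connected G S \<and> v \<in> S} = (\<Union>n\<in>{0..card (verts G)}. K n)"
  proof (intro equalityI subsetI)
    fix S assume S: "S \<in> {S. S \<subseteq> verts G \<and> cut_connected G S \<and> v \<in> S}"
    then have "0 < card S" "card S \<le> card (verts G)"
      using finV by (auto simp: card_gt_0_iff intro: finite_subset card_mono)
    then show "S \<in> (\<Union>n\<in>{0..card (verts G)}. K n)"
      using S by (auto simp: K_def intro!: bexI[of _ "card S - 1"])
  qed (auto simp: K_def)
  then have "(\<Sum>S | S \<subseteq> verts G \<and> cut_connected G S \<and> v \<in> S. q ^ card S)
      = (\<Sum>S\<in>(\<Union>n\<in>{0..card (verts G)}. K n). q ^ card S)" by simp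
  also have "\<dots> \<le> (\<Sum>n=0..card (verts G). \<Sum>S\<in>K n. q ^ card S)"
    using fin by (intro sum_UN_le) (auto simp: q_def)
  also have "\<dots> \<le> (\<Sum>n=0..card (verts G). q * (1 / 8) ^ n)"
  proof (rule sum_mono)
    fix n
    have "(\<Sum>S\<in>K n. q ^ card S) = real (card (K n)) * q ^ Suc n" by (simp add: K_def)
    also have "\<dots> \<le> real (d ^ (2 * n)) * q ^ Suc n"
      using card_cut_connected_le[OF assms(1-3)]
      by (intro mult_right_mono of_nat_mono) (auto simp: K_def q_def)
    also have "\<dots> = q * (real d ^ 2 * q) ^ n" by (simp add: power_mult power_mult_distrib)
    also have "real d ^ 2 * q = 1 / 8" using \<open>0 < d\<close> by (simp add: q_def)
    finally show "(\<Sum>S\<in>K n. q ^ card S) \<le> q * (1 / 8) ^ n" .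
  qed
  also have "\<dots> = q * (\<Sum>n=0..card (verts G). (1 / 8) ^ n)" by (simp add: sum_distrib_left)
  also have "\<dots> \<le> q * (8 / 7)"
    using sum_geometric_le[of "1 / 8" 0] by (intro mult_left_mono) (auto simp: q_def)
  also have "\<dots> = 1 / (7 * real d ^ 2)" by (simp add: q_def)
  finally show ?thesis by (simp add: q_def)
qed

text \<open>The cycles of length k through \<open>v\<close> have total weight at most (r q)^k \<le>
  4^(-k), and lengths start at 3. The application has q = 2 p and r = 1 / (8 p).\<close>

lemma sum_cycle_weights_le:
  fixes q r :: real
  assumes "finite_simple_graph G" "0 \<le> q" "0 \<le> r" "r * q \<le> 1 / 4"
    and count: "\<And>k. k < g \<Longrightarrow> real (card {C \<in> cycles G k. v \<in> verts C}) \<le> r ^ k"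
  shows "(\<Sum>C | (\<exists>k<g. C \<in> cycles G k) \<and> v \<in> verts C. q ^ card (verts C)) \<le> 1 / 48"
proof -
  have "{C. (\<exists>k<g. C \<in> cycles G k) \<and> v \<in> verts C}
      = (\<Union>k\<in>{3..<g}. {C \<in> cycles G k. v \<in> verts C})"
    using cycle_graphD(1) by (fastforce simp: cycles_def)
  then have "(\<Sum>C | (\<exists>k<g. C \<in> cycles G k) \<and> v \<in> verts C. q ^ card (verts C))
      = (\<Sum>C\<in>(\<Union>k\<in>{3..<g}. {C \<in> cycles G k. v \<in> verts C}). q ^ card (verts C))" by simp
  also have "\<dots> \<le> (\<Sum>k=3..<g. \<Sum>C | C \<in> cycles G k \<and> v \<in> verts C. q ^ card (verts C))"
    using finite_cycles[OF assms(1)] \<open>0 \<le> q\<close> by (intro sum_UN_le) auto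
  also have "\<dots> \<le> (\<Sum>k=3..<g. (1 / 4) ^ k)"
  proof (rule sum_mono)
    fix k assume k: "k \<in> {3..<g}"
    have "(\<Sum>C | C \<in> cycles G k \<and> v \<in> verts C. q ^ card (verts C))
        = (\<Sum>C | C \<in> cycles G k \<and> v \<in> verts C. q ^ k)"
      by (intro sum.cong) (auto simp: cycles_def cycle_graphD)
    also have "\<dots> = real (card {C \<in> cycles G k. v \<in> verts C}) * q ^ k" by simp
    also have "\<dots> \<le> r ^ k * q ^ k"
      using k \<open>0 \<le> q\<close> by (intro mult_right_mono count) auto
    also have "\<dots> = (r * q) ^ k" by (simp add: power_mult_distrib)
    also have "\<dots> \<le> (1 / 4) ^ k"
      using assms by (intro power_mono) auto
    finally show "(\<Sum>C | C \<in> cycles G k \<and> v \<in> verts C. q ^ card (verts C)) \<le> (1 / 4) ^ k" .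
  qed
  also have "\<dots> \<le> (\<Sum>k=3..g. (1 / 4) ^ k)" by (intro sum_mono2) auto
  also have "\<dots> \<le> (1 / 4) ^ 3 / (1 - 1 / 4)" by (intro sum_geometric_le) auto
  also have "\<dots> = 1 / 48" by (simp add: power3_eq_cube)
  finally show ?thesis .
qed

text \<open>For 0 \<le> x \<le> 1 / 2 one has ln (1 - x) \<ge> - x - 2 x^2 \<ge> - 2 x. This reduces
  the product condition of the local lemma to a bound on the total weight of the neighbours.\<close>

lemma prod_one_minus_ge_exp:
  fixes x :: "'b \<Rightarrow> real"
  assumes "\<And>j. j \<in> N \<Longrightarrow> 0 \<le> x j" "\<And>j. j \<in> N \<Longrightarrow> x j \<le> 1 / 2"
  shows "exp (- 2 * sum x N) \<le> (\<Prod>j\<in>N. 1 - x j)"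
proof (cases "finite N")
  case True
  have "exp (- 2 * sum x N) = (\<Prod>j\<in>N. exp (- 2 * x j))"
    using True by (simp add: sum_distrib_left exp_sum)
  also have "\<dots> \<le> (\<Prod>j\<in>N. 1 - x j)"
  proof (rule prod_mono)
    fix j assume "j \<in> N"
    then have x: "0 \<le> x j" "x j \<le> 1 / 2" using assms by auto
    then have "x j * x j \<le> x j * (1 / 2)" by (intro mult_left_mono) auto
    then have "- 2 * x j \<le> ln (1 - x j)"
      using ln_one_minus_pos_lower_bound[OF x] by (simp add: power2_eq_square)
    then have "exp (- 2 * x j) \<le> exp (ln (1 - x j))" by simp
    then show "0 \<le> exp (- 2 * x j) \<and> exp (- 2 * x j) \<le> 1 - x j" using x by simp
  qed
  finally show ?thesis .
qed simp

lemma girth_geI: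
  assumes "\<And>k. k < g \<Longrightarrow> cycles H k = {}"
  shows "enat g \<le> girth H"
  unfolding girth_def using assms by (intro INF_greatest) (auto simp: not_less[symmetric])

text \<open>Per vertex the left side is exp (- 4) / d^2, and exp (7 / 2) \<ge> 8 lets the constant 4
  pay for the 8 in the weight and for exp (- 1 / 2), which is reserved for the neighbours.\<close>

lemma exp_boundary_deviation_le:
  assumes "0 < d"
  shows "exp (- ((2 * ln (real d) + 4) * real s)) \<le> (1 / (8 * real d ^ 2)) ^ s * exp (- (real s / 2))"
proof -
  have d: "exp (2 * ln (real d)) = real d ^ 2"
    using assms by (simp add: exp_of_nat_mult[of 2, simplified])
  have "(2::real) ^ 3 \<le> exp 1 ^ 3"
    using exp_ge_add_one_self[of 1] by (intro power_mono) auto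
  also have "\<dots> = exp (3::real)" by (simp flip: exp_of_nat_mult)
  also have "\<dots> \<le> exp (7 / 2)" by simp
  finally have "exp (- (4::real)) * 8 \<le> exp (- 4) * exp (7 / 2)" by simp
  also have "\<dots> = exp (- (1 / 2))" by (simp flip: exp_add)
  finally have "exp (- 4) / real d ^ 2 \<le> exp (- (1 / 2)) / 8 / real d ^ 2"
    by (intro divide_right_mono) auto
  also have "exp (- 4) / real d ^ 2 = exp (- (2 * ln (real d) + 4))"
    by (simp add: exp_diff exp_minus d field_simps flip: exp_add)
  finally have "exp (- (2 * ln (real d) + 4)) ^ s \<le> (1 / (8 * real d ^ 2) * exp (- (1 / 2))) ^ s"
    by (intro power_mono) auto
  moreover have "exp (- (2 * ln (real d) + 4)) ^ s = exp (- ((2 * ln (real d) + 4) * real s))"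
    by (simp only: exp_of_nat_mult[symmetric]) (simp add: algebra_simps)
  moreover have "exp (- (1 / 2)) ^ s = exp (- (real s / 2))"
    by (simp flip: exp_of_nat_mult)
  ultimately show ?thesis by (simp only: power_mult_distrib)
qed

section \<open>The local lemma applied to a random subgraph\<close>

text \<open>The balance for an event supported on n vertices: its probability is at most its weight
  times exp (- n / 2), while its neighbours have total weight at most n / 4, so their product is at
  least exp (- 2 n / 4).\<close>

lemma sparse_subgraph_exists:
  fixes G :: "'a graph" and p :: real
  assumes G: "finite_simple_graph G" and deg: "\<And>v. v \<in> verts G \<Longrightarrow> degree G v \<le> d"
    and p: "0 < p" "p \<le> 1 / 8" and "2 \<le> d"
    and count: "\<And>k v. k < g \<Longrightarrow> v \<in> verts G \<Longrightarrow>
      real (card {C \<in> cycles G k. v \<in> verts C}) \<le> (1 / (8 * p)) ^ k"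
  shows "\<exists>H. spanning_subgraph H G \<and> enat g \<le> girth H \<and>
    (\<forall>S. S \<subseteq> verts G \<longrightarrow> p / 2 * real (card (edge_boundary G S))
       - (2 * ln (real d) + 4) * real (card S) \<le> real (card (edge_boundary H S)))"
proof -
  define c where "c = 2 * ln (real d) + 4"
  define Cyc where "Cyc = {C. \<exists>k<g. C \<in> cycles G k}"
  define Con where "Con = {S. S \<subseteq> verts G \<and> S \<noteq> {} \<and> cut_connected G S}"
  \<comment> \<open>Cycle events are tagged \<open>Inl\<close> and boundary events
    \<open>Inr\<close>. For an event \<open>i\<close>, \<open>U i\<close> is the supporting vertex
    set, \<open>F i\<close> the set of edges it depends on and \<open>x i\<close> its
    weight.\<close>
  define I where "I = Inl ` Cyc \<union> Inr ` Con"
  define U :: "'a graph + 'a set \<Rightarrow> 'a set" where "U = case_sum verts id"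
  define F :: "'a graph + 'a set \<Rightarrow> 'a set set" where "F = case_sum edges (edge_boundary G)"
  define x where "x = case_sum (\<lambda>C :: 'a graph. (2 * p) ^ card (verts C))
    (\<lambda>S :: 'a set. (1 / (8 * real d ^ 2)) ^ card S)"
  define A :: "'a graph + 'a set \<Rightarrow> ('a set \<Rightarrow> bool) set" where "A = case_sum (\<lambda>C. {f. \<forall>e\<in>edges C. f e}) (\<lambda>S. {f. real (card {e \<in> edge_boundary G S. f e})
      < p / 2 * real (card (edge_boundary G S)) - c * real (card S)})"
  define N where "N i = {j \<in> I. F i \<inter> F j \<noteq> {}}" for i
  define M where "M = Pi_pmf (edges G) False (\<lambda>_. bernoulli_pmf p)"
  define nbrs where "nbrs u = {w. {u, w} \<in> edges G}" for u
  define CycAt where "CycAt u = {C. (\<exists>k<g. C \<in> cycles G k) \<and> u \<in> verts C}" for u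
  define ConAt where "ConAt u = {S. S \<subseteq> verts G \<and> cut_connected G S \<and> u \<in> S}" for u

  have finV: "finite (verts G)" using G by (simp add: finite_simple_graph_def)
  have finE: "finite (edges G)" using finite_edges[OF G] .
  have "Cyc = (\<Union>k<g. cycles G k)" by (auto simp: Cyc_def)
  then have finCyc: "finite Cyc" using finite_cycles[OF G] by simp
  then have finCycAt: "finite (CycAt u)" for u
    by (rule finite_subset[rotated]) (auto simp: CycAt_def Cyc_def)
  have "ConAt u \<subseteq> Pow (verts G)" for u by (auto simp: ConAt_def)
  then have finConAt: "finite (ConAt u)" for u using finV by (meson finite_Pow_iff finite_subset)
  have "Con \<subseteq> Pow (verts G)" by (auto simp: Con_def)
  then have "finite Con" using finV by (meson finite_Pow_iff finite_subset)
  then have finI: "finite I" using finCyc by (simp add: I_def)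
  have Cyc: "3 \<le> card (verts C)" "card (edges C) = card (verts C)" "finite (verts C)"
    "verts C \<subseteq> verts G" "edges C \<subseteq> edges G" "\<And>e. e \<in> edges C \<Longrightarrow> e \<subseteq> verts C" if "C \<in> Cyc" for C
  proof -
    obtain k where "cycle_graph k C" "subgraph C G" using \<open>C \<in> Cyc\<close> by (auto simp: Cyc_def cycles_def)
    then show "3 \<le> card (verts C)" "card (edges C) = card (verts C)" "finite (verts C)"
      "verts C \<subseteq> verts G" "edges C \<subseteq> edges G" "\<And>e. e \<in> edges C \<Longrightarrow> e \<subseteq> verts C"
      using cycle_graphD[of k C] by (simp_all add: subgraph_def)
  qed
  have Con: "finite S" "0 < card S" "S \<subseteq> verts G" if "S \<in> Con" for S
    using that finV by (auto simp: Con_def card_gt_0_iff intro: finite_subset)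
  have IE: thesis if "i \<in> I" "\<And>C. i = Inl C \<Longrightarrow> C \<in> Cyc \<Longrightarrow> thesis"
    "\<And>S. i = Inr S \<Longrightarrow> S \<in> Con \<Longrightarrow> thesis" for i thesis
    using that by (auto simp: I_def)

  have U: "finite (U i) \<and> U i \<subseteq> verts G \<and> 0 < card (U i)" if "i \<in> I" for i
    using that
  proof (rule IE)
    fix C assume "i = Inl C" "C \<in> Cyc"
    then show ?thesis using Cyc(1,3,4)[of C] by (simp add: U_def)
  next
    fix S assume "i = Inr S" "S \<in> Con"
    then show ?thesis using Con[of S] by (simp add: U_def)
  qed
  have F_sub: "F i \<subseteq> edges G" if "i \<in> I" for i
    using that
  proof (rule IE)
    fix C assume "i = Inl C" "C \<in> Cyc"
    then show ?thesis using Cyc(5)[of C] by (simp add: F_def)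
  qed (auto simp: F_def edge_boundary_def)
  \<comment> \<open>Links edges to vertices: an edge shared by \<open>F i\<close> and
    \<open>F j\<close> has an endpoint in \<open>U i\<close> and one in \<open>U j\<close>, so
    neighbours can be counted from the vertices of \<open>U i\<close>.\<close>
  have F_meets: "e \<inter> U i \<noteq> {}" if "i \<in> I" "e \<in> F i" for i e
    using that(1)
  proof (rule IE)
    fix C assume i: "i = Inl C" "C \<in> Cyc"
    then have "e \<subseteq> verts C" "e \<in> edges G" using that Cyc(5,6)[of C] by (auto simp: F_def)
    then show ?thesis using i by (auto simp: U_def elim: edge_cases[OF G])
  next
    fix S assume "i = Inr S" "S \<in> Con"
    then show ?thesis using that by (auto simp: U_def F_def edge_boundary_def)
  qed
  have x_nonneg: "0 \<le> x i" for i using p by (cases i) (auto simp: x_def)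
  have x_le: "x i \<le> 1 / 2" if "i \<in> I" for i
    using that
  proof (rule IE)
    fix C assume "i = Inl C" "C \<in> Cyc"
    then show ?thesis
      using p Cyc(1)[of C] power_decreasing[of 1 "card (verts C)" "2 * p"] by (auto simp: x_def)
  next
    fix S assume S: "i = Inr S" "S \<in> Con"
    have "1 \<le> real d ^ 2" using \<open>2 \<le> d\<close> by simp
    then have "0 < 8 * real d ^ 2" "1 \<le> 1 / 2 * (8 * real d ^ 2)" by linarith+
    then have "1 / (8 * real d ^ 2) \<le> 1 / 2" by (simp only: pos_divide_le_eq)
    then show ?thesis
      using S Con(2)[of S] power_decreasing[of 1 "card S" "1 / (8 * real d ^ 2)"] by (auto simp: x_def)
  qed
  have depends: "f \<in> A i \<longleftrightarrow> h \<in> A i" if "\<And>e. e \<in> F i \<Longrightarrow> f e = h e" for f h i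
  proof (cases i)
    case (Inr S)
    then have "{e \<in> edge_boundary G S. f e} = {e \<in> edge_boundary G S. h e}"
      using that by (auto simp: F_def)
    then show ?thesis by (simp add: A_def Inr)
  qed (use that in \<open>auto simp: A_def F_def\<close>)

  have prob_A: "measure_pmf.prob M (A i) \<le> x i * exp (- (real (card (U i)) / 2))" if "i \<in> I" for i
    using that
  proof (rule IE)
    fix C assume i: "i = Inl C" "C \<in> Cyc"
    have "measure_pmf.prob M (A i) = p ^ card (verts C)"
      using prob_Pi_pmf_bernoulli_all[OF finE, of "edges C" p] Cyc[of C] i p
      by (simp add: M_def A_def)
    \<comment> \<open>The factor 2 in the cycle weight pays for exp (- 1 / 2) per vertex, as exp (-
      1 / 2) \<ge> 1 / 2.\<close>
    also have "p \<le> 2 * p * exp (- (1 / 2))"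
      using exp_ge_add_one_self[of "- (1 / 2)"] p by simp
    then have "p ^ card (verts C) \<le> (2 * p * exp (- (1 / 2))) ^ card (verts C)"
      using p by (intro power_mono) auto
    also have "\<dots> = x i * exp (- (real (card (U i)) / 2))"
      by (simp add: i x_def U_def power_mult_distrib flip: exp_of_nat_mult)
    finally show ?thesis .
  next
    fix S assume i: "i = Inr S" "S \<in> Con"
    have "measure_pmf.prob M (A i) \<le> exp (- (c * real (card S)))"
      unfolding i A_def M_def sum.case using p finE
      by (intro prob_Pi_pmf_bernoulli_lower_tail) (auto simp: edge_boundary_def)
    also have "\<dots> \<le> x i * exp (- (real (card (U i)) / 2))"
      using exp_boundary_deviation_le[of d "card S"] \<open>2 \<le> d\<close> by (simp add: i c_def x_def U_def)
    finally show ?thesis .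
  qed

  have sum_N: "sum x (N i) \<le> real (card (U i)) / 4" if i: "i \<in> I" for i
  proof -
    define CN where "CN = (\<Union>u\<in>U i. CycAt u)"
    \<comment> \<open>A cycle through the shared edge contains both its endpoints, in particular the
      one in \<open>U i\<close>. A boundary event has only one endpoint in its set, perhaps the
      other one, so neighbours of \<open>u\<close> must be included.\<close>
    define SN where "SN = (\<Union>u\<in>U i. \<Union>w\<in>insert u (nbrs u). ConAt w)"
    have fin: "finite CN" "finite SN"
      unfolding CN_def SN_def nbrs_def
      using U[OF i] finCycAt finConAt card_neighbours_le_degree[OF G] by auto
    have "N i \<subseteq> Inl ` CN \<union> Inr ` SN"
    proof
      fix j assume "j \<in> N i"
      then obtain e where j: "j \<in> I" and e: "e \<in> F i" "e \<in> F j" by (auto simp: N_def)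
      obtain u where u: "u \<in> U i" "u \<in> e" using F_meets[OF i e(1)] by auto
      obtain w where w: "w \<in> U j" "w \<in> e" using F_meets[OF j e(2)] by auto
      have eG: "e \<in> edges G" using F_sub[OF i] e by auto
      show "j \<in> Inl ` CN \<union> Inr ` SN"
        using j
      proof (rule IE)
        fix C assume "j = Inl C" "C \<in> Cyc"
        then show ?thesis using Cyc(6)[of C e] e u by (auto simp: CN_def CycAt_def Cyc_def F_def)
      next
        fix S assume S: "j = Inr S" "S \<in> Con"
        obtain a b where "e = {a, b}" using edge_cases[OF G eG] .
        then have "w = u \<or> e = {u, w}" using u w by auto
        then have "w \<in> insert u (nbrs u)" using eG by (auto simp: nbrs_def)
        then show ?thesis using S w u by (auto simp: SN_def ConAt_def Con_def U_def)
      qed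
    qed
    then have "sum x (N i) \<le> sum x (Inl ` CN \<union> Inr ` SN)"
      using fin x_nonneg by (intro sum_mono2) auto
    also have "\<dots> = sum (x \<circ> Inl) CN + sum (x \<circ> Inr) SN"
      using fin by (subst sum.union_disjoint) (auto simp: sum.reindex)
    also have "sum (x \<circ> Inl) CN \<le> (\<Sum>u\<in>U i. sum (x \<circ> Inl) (CycAt u))"
      unfolding CN_def using U[OF i] finCycAt x_nonneg by (intro sum_UN_le) auto
    also have "\<dots> \<le> (\<Sum>u\<in>U i. 1 / 48)"
    proof (rule sum_mono)
      fix u assume "u \<in> U i"
      then have "u \<in> verts G" using U[OF i] by auto
      then show "sum (x \<circ> Inl) (CycAt u) \<le> 1 / 48"
        unfolding CycAt_def x_def comp_def sum.case using p
        by (intro sum_cycle_weights_le[OF G, where r = "1 / (8 * p)"] count) auto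
    qed
    also have "sum (x \<circ> Inr) SN \<le> (\<Sum>u\<in>U i. sum (x \<circ> Inr) (\<Union>w\<in>insert u (nbrs u). ConAt w))"
      unfolding SN_def nbrs_def using U[OF i] finConAt card_neighbours_le_degree[OF G] x_nonneg
      by (intro sum_UN_le) auto
    also have "\<dots> \<le> (\<Sum>u\<in>U i. 1 / 7)"
    proof (rule sum_mono)
      fix u assume "u \<in> U i"
      then have u: "u \<in> verts G" using U[OF i] by auto
      have nbrs: "finite (nbrs u)" "card (nbrs u) \<le> d"
        using card_neighbours_le_degree[OF G, of u] deg[OF u] by (auto simp: nbrs_def)
      have "sum (x \<circ> Inr) (\<Union>w\<in>insert u (nbrs u). ConAt w)
          \<le> (\<Sum>w\<in>insert u (nbrs u). sum (x \<circ> Inr) (ConAt w))"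
        using nbrs finConAt x_nonneg by (intro sum_UN_le) auto
      also have "\<dots> \<le> (\<Sum>w\<in>insert u (nbrs u). 1 / (7 * real d ^ 2))"
      proof (rule sum_mono)
        fix w assume "w \<in> insert u (nbrs u)"
        then have "w \<in> verts G" using u G by (auto simp: nbrs_def finite_simple_graph_def)
        then show "sum (x \<circ> Inr) (ConAt w) \<le> 1 / (7 * real d ^ 2)"
          unfolding ConAt_def x_def comp_def sum.case
          using \<open>2 \<le> d\<close> by (intro sum_cut_connected_weights_le[OF G deg]) auto
      qed
      also have "\<dots> = real (card (insert u (nbrs u))) * (1 / (7 * real d ^ 2))" by simp
      also have "\<dots> \<le> real (Suc d) * (1 / (7 * real d ^ 2))"
        using nbrs card_insert_le_m1[of "Suc d" "nbrs u" u] by (intro mult_right_mono) auto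
      \<comment> \<open>Uses d + 1 \<le> d^2, valid from d = 2 on.\<close>
      also have "\<dots> \<le> 1 / 7"
      proof -
        have "2 * d \<le> d * d" using \<open>2 \<le> d\<close> by (rule mult_right_mono) simp
        then have "Suc d \<le> d ^ 2" unfolding power2_eq_square using \<open>2 \<le> d\<close> by linarith
        then have "real (Suc d) \<le> real d ^ 2" by (metis of_nat_le_iff of_nat_power)
        then show ?thesis using \<open>2 \<le> d\<close> by (simp add: field_simps)
      qed
      finally show "sum (x \<circ> Inr) (\<Union>w\<in>insert u (nbrs u). ConAt w) \<le> 1 / 7" .
    qed
    \<comment> \<open>Per vertex of \<open>U i\<close> the total is 1 / 48 + 1 / 7, below 1 /
      4.\<close>
    finally show ?thesis by simp
  qed

  have "(\<Prod>i\<in>I. 1 - x i) \<le> measure_pmf.prob M (space M - (\<Union>i\<in>I. A i))"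
  proof (rule measure_pmf.lovasz_local_lemma[OF finI, where N = N])
    fix i J assume i: "i \<in> I" and J: "J \<subseteq> I - N i"
    \<comment> \<open>Avoiding the events of \<open>J\<close> depends only on the edges in the union
      of their sets \<open>F j\<close>, which is disjoint from \<open>F i\<close> because
      \<open>J\<close> misses \<open>N i\<close>.\<close>
    show "measure_pmf.prob M (A i \<inter> (space M - (\<Union>j\<in>J. A j)))
        = measure_pmf.prob M (A i) * measure_pmf.prob M (space M - (\<Union>j\<in>J. A j))"
      unfolding M_def
    proof (rule prob_Pi_pmf_Int_disjoint_coordinates[OF finE, of "F i" "\<Union>j\<in>J. F j"])
      show "F i \<inter> (\<Union>j\<in>J. F j) = {}" using J by (auto simp: N_def)
      show "f \<in> A i \<longleftrightarrow> h \<in> A i" if "\<And>e. e \<in> F i \<Longrightarrow> f e = h e" for f h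
        using that by (rule depends)
      show "f \<in> space (Pi_pmf (edges G) False (\<lambda>_. bernoulli_pmf p)) - (\<Union>j\<in>J. A j) \<longleftrightarrow>
          h \<in> space (Pi_pmf (edges G) False (\<lambda>_. bernoulli_pmf p)) - (\<Union>j\<in>J. A j)"
        if "\<And>e. e \<in> (\<Union>j\<in>J. F j) \<Longrightarrow> f e = h e" for f h
      proof -
        have "f \<in> A j \<longleftrightarrow> h \<in> A j" if "j \<in> J" for j
          by (rule depends) (use that \<open>\<And>e. e \<in> (\<Union>j\<in>J. F j) \<Longrightarrow> f e = h e\<close> in auto)
        then show ?thesis by auto
      qed
    qed (use i J F_sub in auto)
  next
    fix i assume i: "i \<in> I"
    show "measure_pmf.prob M (A i) \<le> x i * (\<Prod>j\<in>N i. 1 - x j)"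
    proof -
      have "exp (- (real (card (U i)) / 2)) \<le> exp (- 2 * sum x (N i))" using sum_N[OF i] by simp
      also have "\<dots> \<le> (\<Prod>j\<in>N i. 1 - x j)"
        using x_nonneg x_le by (intro prod_one_minus_ge_exp) (auto simp: N_def)
      finally have "x i * exp (- (real (card (U i)) / 2)) \<le> x i * (\<Prod>j\<in>N i. 1 - x j)"
        using x_nonneg by (intro mult_left_mono)
      then show ?thesis using prob_A[OF i] by linarith
    qed
    show "x i \<le> 1" using x_le[OF i] by simp
  qed (use x_nonneg in \<open>auto simp: N_def\<close>)
  moreover have "0 < (\<Prod>i\<in>I. 1 - x i)"
    using x_le by (intro prod_pos) fastforce
  \<comment> \<open>Positive probability yields an outcome \<open>f\<close> avoiding every bad
    event; the edges with \<open>f e\<close> form \<open>H\<close>.\<close>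
  ultimately have "space M - (\<Union>i\<in>I. A i) \<noteq> {}" by (metis less_le_not_le measure_empty)
  then obtain f where f: "\<And>i. i \<in> I \<Longrightarrow> f \<notin> A i" by auto

  define H where "H = \<lparr>verts = verts G, edges = {e \<in> edges G. f e}\<rparr>"
  have H: "edges H \<subseteq> edges G" by (auto simp: H_def)
  have bound: "p / 2 * real (card (edge_boundary G S)) - c * real (card S) \<le> real (card (edge_boundary H S))"
    if "S \<subseteq> verts G" "S \<noteq> {}" "cut_connected G S" for S
  proof -
    have "f \<notin> A (Inr S)" using that by (intro f) (auto simp: I_def Con_def)
    moreover have "{e \<in> edge_boundary G S. f e} = edge_boundary H S"
      by (auto simp: edge_boundary_def H_def)
    ultimately show ?thesis by (simp add: A_def)
  qed
  have "cycles H k = {}" if "k < g" for k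
  proof (rule ccontr)
    assume "cycles H k \<noteq> {}"
    then obtain C where C: "subgraph C H" "cycle_graph k C" by (auto simp: cycles_def)
    then have "C \<in> cycles G k" using H by (auto simp: cycles_def subgraph_def H_def)
    then have "f \<notin> A (Inl C)" using that by (intro f) (auto simp: I_def Cyc_def)
    then show False using C by (auto simp: A_def subgraph_def H_def)
  qed
  then have "enat g \<le> girth H" by (rule girth_geI)
  moreover have "spanning_subgraph H G" by (auto simp: spanning_subgraph_def H_def)
  ultimately show ?thesis
    using edge_boundary_bound_if_cut_connected[OF G H bound] unfolding c_def by blast
qed

section \<open>The two ranges of \<delta>\<close>

theorem theorem1p2:
  fixes G :: "'a graph" and d g \<delta> :: nat
  assumes "d > 0" and "g > 0" and "\<delta> > 0"
    and "real \<delta> / 2 - (2 * ln (real d) + 4) \<le> real d"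
    and "finite_simple_graph G" and "regular d G"
    and "\<And>k x. k \<le> g \<Longrightarrow> x \<in> verts G \<Longrightarrow>
           real (card {C \<in> cycles G k. x \<in> verts C}) \<le> (real d / (8 * real \<delta>)) ^ k"
  shows "\<exists>H. spanning_subgraph H G \<and> girth H \<ge> enat g \<and>
           (\<forall>S. S \<subseteq> verts G \<longrightarrow>
              real (card (edge_boundary H S)) \<ge>
                real \<delta> / (2 * real d) * real (card (edge_boundary G S))
                - (2 * ln (real d) + 4) * real (card S))"
proof (cases "8 * \<delta> \<le> d")
  case True
  \<comment> \<open>Here p = \<delta> / d, which turns 1 / (8 p) into the given base d / (8
    \<delta>). Also d \<ge> 8 gives \<open>2 \<le> d\<close>.\<close>
  then have "real \<delta> / real d \<le> 1 / 8" using \<open>d > 0\<close> by (simp add: field_simps)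
  moreover have "1 / (8 * (real \<delta> / real d)) = real d / (8 * real \<delta>)" by simp
  moreover have "real \<delta> / real d / 2 = real \<delta> / (2 * real d)" by simp
  ultimately show ?thesis
    using sparse_subgraph_exists[OF assms(5), of d "real \<delta> / real d" g] assms True
    by (simp add: regular_def mult.commute)
next
  case False
  have no_cycles: "cycles G k = {}" if "k < g" for k
  proof (rule ccontr)
    assume "cycles G k \<noteq> {}"
    then obtain C where C: "C \<in> cycles G k" by auto
    then have cyc: "cycle_graph k C" "verts C \<subseteq> verts G" by (auto simp: cycles_def subgraph_def)
    then obtain v where v: "v \<in> verts C" using cycle_graphD[OF cyc(1)] by fastforce
    have "finite {C \<in> cycles G k. v \<in> verts C}" using finite_cycles[OF assms(5)] by simp
    then have "1 \<le> card {C \<in> cycles G k. v \<in> verts C}"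
      using C v by (auto simp: Suc_le_eq card_gt_0_iff)
    \<comment> \<open>The base is below 1 and k is positive, so fewer than one cycle of length k is
      allowed at \<open>v\<close>.\<close>
    moreover have "(real d / (8 * real \<delta>)) ^ k < 1"
      using False assms(1,3) cycle_graphD(1)[OF cyc(1)] by (intro power_less_one_iff[THEN iffD2]) auto
    ultimately show False using assms(7)[of k v] that cyc v by auto
  qed
  have "real \<delta> / (2 * real d) * real (card (edge_boundary G S)) - (2 * ln (real d) + 4) * real (card S)
      \<le> real (card (edge_boundary G S))" if S: "S \<subseteq> verts G" for S
  proof -
    have "finite S" using S assms(5) by (meson finite_simple_graph_def finite_subset)
    then have "card (edge_boundary G S) \<le> d * card S"
      using S assms(5,6) by (intro card_edge_boundary_le) (auto simp: regular_def)
    then have b: "real (card (edge_boundary G S)) \<le> real d * real (card S)"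
      by (metis of_nat_le_iff of_nat_mult)
    have ln: "0 \<le> ln (real d)" using \<open>d > 0\<close> by simp
    show ?thesis
    proof (cases "\<delta> \<le> 2 * d")
      case True
      then have "real \<delta> / (2 * real d) \<le> 1" using \<open>d > 0\<close> by (simp add: field_simps)
      then have "real \<delta> / (2 * real d) * real (card (edge_boundary G S)) \<le> real (card (edge_boundary G S))"
        by (intro mult_left_le_one_le) auto
      moreover have "0 \<le> (2 * ln (real d) + 4) * real (card S)" using ln by simp
      ultimately show ?thesis by linarith
    next
      case False
      \<comment> \<open>The coefficient of the boundary now exceeds 1. Its excess is controlled by
        the boundary bound d |S|, leaving (\<delta> / 2 - d) |S|, and the hypothesis relating
        \<delta> and d absorbs this in the error term.\<close>
      then have "0 \<le> real \<delta> / (2 * real d) - 1" using \<open>d > 0\<close> by (simp add: field_simps)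
      then have "(real \<delta> / (2 * real d) - 1) * real (card (edge_boundary G S))
          \<le> (real \<delta> / (2 * real d) - 1) * (real d * real (card S))"
        using b by (rule mult_left_mono[rotated])
      also have "\<dots> = (real \<delta> / 2 - real d) * real (card S)"
        using \<open>d > 0\<close> by (simp add: field_simps)
      also have "\<dots> \<le> (2 * ln (real d) + 4) * real (card S)"
        using assms(4) by (intro mult_right_mono) auto
      finally show ?thesis by (simp add: algebra_simps)
    qed
  qed
  then show ?thesis
    using girth_geI[OF no_cycles] by (intro exI[of _ G]) (simp add: spanning_subgraph_def)
qed

end
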